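(* For each integer $t\ge 0$ there exists a planar graph $G_t$ with $\chi_{\mathrm{os}}(G_t)=8$ and $\mathrm{ods}(G_t)=4^t$.
   Context: Graphs are finite, simple and undirected. For a vertex $v$ of a graph $G$, $N(v)=\{x: vx\in E(G)\}$ and $N[v]=N(v)\cup\{v\}$. A coloring of $G$ is a map $f:V(G)\to\mathbb{Z}^+$ (positive integers) such that $f(v)\ne f(w)$ for all $vw\in E(G)$. A coloring $f$ is an odd-sum coloring if $\sum_{w\in N[v]}f(w)$ is odd for each vertex $v\in V(G)$. The odd-sum chromatic number $\chi_{\mathrm{os}}(G)$ is the minimum size of the range of an odd-sum coloring of $G$ (it is known that every finite graph has an odd-sum coloring). A set $D\subseteq V(G)$ is odd-dominating if $|N[x]\cap D|$ is odd for all $x\in V(G)$; $\mathrm{ods}(G)$ denotes the number of odd-dominating sets of $G$. *)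

theory Defs
  imports "HOL-Analysis.Analysis" "Graph_Theory.Pair_Digraph"
begin

text \<open>
  A finite simple undirected graph is a digraph \<open>G\<close> with \<open>pair_graph G\<close>: finite, loop-free, and
  with an arc set that is a symmetric relation. The undirected edge between \<open>u\<close> and \<open>v\<close> is thus
  stored as the two arcs \<open>(u, v)\<close> and \<open>(v, u)\<close>.
\<close>

definition edges :: "'a pair_pre_digraph \<Rightarrow> 'a set set" where
  "edges G = {{u, v} | u v. (u, v) \<in> parcs G}"

definition nbhd :: "'a pair_pre_digraph \<Rightarrow> 'a \<Rightarrow> 'a set" where
  "nbhd G v = {x. (v, x) \<in> parcs G}"

definition closed_nbhd :: "'a pair_pre_digraph \<Rightarrow> 'a \<Rightarrow> 'a set" where
  "closed_nbhd G v = nbhd G v \<union> {v}"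

definition plane_drawing ::
    "'a pair_pre_digraph \<Rightarrow> ('a \<Rightarrow> real ^ 2) \<Rightarrow> ('a set \<Rightarrow> real \<Rightarrow> real ^ 2) \<Rightarrow> bool" where
  "plane_drawing G p \<gamma> \<longleftrightarrow>
     inj_on p (pverts G) \<and>
     (\<forall>e \<in> edges G. arc (\<gamma> e) \<and> {pathstart (\<gamma> e), pathfinish (\<gamma> e)} = p ` e \<and>
        path_image (\<gamma> e) \<inter> p ` pverts G = p ` e) \<and>
     (\<forall>e \<in> edges G. \<forall>e' \<in> edges G. e \<noteq> e' \<longrightarrow>
        path_image (\<gamma> e) \<inter> path_image (\<gamma> e') = p ` (e \<inter> e'))"

definition planar :: "'a pair_pre_digraph \<Rightarrow> bool" where
  "planar G \<longleftrightarrow> (\<exists>p \<gamma>. plane_drawing G p \<gamma>)"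

text \<open>
  Colours are positive integers, represented as nonzero natural numbers; only the values of a
  colouring on the vertex set matter.
\<close>

definition coloring :: "'a pair_pre_digraph \<Rightarrow> ('a \<Rightarrow> nat) \<Rightarrow> bool" where
  "coloring G f \<longleftrightarrow> (\<forall>v \<in> pverts G. f v > 0) \<and> (\<forall>(v, w) \<in> parcs G. f v \<noteq> f w)"

definition odd_sum_coloring :: "'a pair_pre_digraph \<Rightarrow> ('a \<Rightarrow> nat) \<Rightarrow> bool" where
  "odd_sum_coloring G f \<longleftrightarrow>
     coloring G f \<and> (\<forall>v \<in> pverts G. odd (\<Sum>w \<in> closed_nbhd G v. f w))"

text \<open>
  The minimum below exists, since every finite simple graph has an odd-sum colouring.
\<close>

definition odd_sum_chromatic_number :: "'a pair_pre_digraph \<Rightarrow> nat" where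
  "odd_sum_chromatic_number G =
     (LEAST k. \<exists>f. odd_sum_coloring G f \<and> card (f ` pverts G) = k)"

definition odd_dominating :: "'a pair_pre_digraph \<Rightarrow> 'a set \<Rightarrow> bool" where
  "odd_dominating G D \<longleftrightarrow>
     D \<subseteq> pverts G \<and> (\<forall>x \<in> pverts G. odd (card (closed_nbhd G x \<inter> D)))"

definition ods :: "'a pair_pre_digraph \<Rightarrow> nat" where
  "ods G = card {D. odd_dominating G D}"

end

theory Submission
  imports Defs
begin

text \<open>
  In an odd-sum colouring, the vertices of odd colour form an odd-dominating set, because the parity
  of a sum of colours is the parity of the number of odd summands. So if every odd-dominating set of
  \<open>G\<close> contains one clique on four vertices and avoids another, then every odd-sum colouring of \<open>G\<close>
  uses at least four odd and at least four even colours (\<open>card_colors_ge\<close>).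

  Odd-dominating sets are the solutions over the field with two elements of the linear system
  \<open>(A + I) x = 1\<close>, where \<open>A\<close> is the adjacency matrix. Two small planar graphs have a unique
  solution of the required kind. Let every vertex of a \<open>K\<^sub>4\<close> have a pendant neighbour: then only the
  set of the four leaves is odd-dominating, and it avoids the \<open>K\<^sub>4\<close> (\<open>odd_dominating_even_gadget_iff\<close>).
  Let a \<open>K\<^sub>4\<close> have triangles glued to two opposite edges, and a pendant neighbour at one end of each
  of these edges: then only the set of all vertices except the two leaves is odd-dominating, and it
  contains the \<open>K\<^sub>4\<close> (\<open>odd_dominating_odd_gadget_iff\<close>).

  On a disjoint union, the odd-dominating sets are chosen independently on the two parts, so \<open>ods\<close> is
  multiplicative (\<open>ods_union\<close>). In a triangle every closed neighbourhood is the whole vertex set, so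
  the odd-dominating sets are the four vertex sets of odd size. Hence the disjoint union of the two
  gadgets with \<open>t\<close> triangles has exactly \<open>4 ^ t\<close> odd-dominating sets. It still needs eight
  colours, and an explicit colouring with the colours \<open>1, ..., 8\<close> exists (\<open>extremal_coloring\<close>).

  Planarity is shown by straight-line drawings with integer coordinates, for which the absence
  of crossings is a finite computation with orientations of triples of points
  (\<open>planar_straight_line\<close>), and by moving bounded drawings apart (\<open>planar_union\<close>).
\<close>

section \<open>Graphs from edge sets and disjoint unions\<close>

definition graph_of :: "'a set \<Rightarrow> ('a \<times> 'a) set \<Rightarrow> 'a pair_pre_digraph" where
  "graph_of V E = \<lparr>pverts = V, parcs = E \<union> E\<inverse>\<rparr>"

text \<open>
  Meant for graphs with disjoint vertex sets; the lemmas below assume this where it matters.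
\<close>

definition graph_union :: "'a pair_pre_digraph \<Rightarrow> 'a pair_pre_digraph \<Rightarrow> 'a pair_pre_digraph" where
  "graph_union G H = \<lparr>pverts = pverts G \<union> pverts H, parcs = parcs G \<union> parcs H\<rparr>"

definition clique :: "'a pair_pre_digraph \<Rightarrow> 'a set \<Rightarrow> bool" where
  "clique G K \<longleftrightarrow> K \<subseteq> pverts G \<and> (\<forall>u\<in>K. \<forall>v\<in>K. u \<noteq> v \<longrightarrow> (u, v) \<in> parcs G)"

lemma pverts_graph_of [simp]: "pverts (graph_of V E) = V"
  and parcs_graph_of [simp]: "parcs (graph_of V E) = E \<union> E\<inverse>"
  by (simp_all add: graph_of_def)

lemma pverts_graph_union [simp]: "pverts (graph_union G H) = pverts G \<union> pverts H"
  and parcs_graph_union [simp]: "parcs (graph_union G H) = parcs G \<union> parcs H"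
  by (simp_all add: graph_union_def)

lemma pair_graph_iff:
  "pair_graph G \<longleftrightarrow>
     finite (pverts G) \<and> parcs G \<subseteq> pverts G \<times> pverts G \<and> sym (parcs G) \<and> irrefl (parcs G)"
proof
  assume "pair_graph G"
  then interpret pair_graph G .
  have "sym (parcs G)" using pair_sym_arcs by (simp add: symmetric_def)
  moreover have "irrefl (parcs G)" using pair_no_loops by (fastforce simp: irrefl_def)
  ultimately show "finite (pverts G) \<and> parcs G \<subseteq> pverts G \<times> pverts G \<and> sym (parcs G) \<and> irrefl (parcs G)"
    using pair_finite_verts in_arcsD1 in_arcsD2 by auto
next
  assume *: "finite (pverts G) \<and> parcs G \<subseteq> pverts G \<times> pverts G \<and> sym (parcs G) \<and> irrefl (parcs G)"
  then have "finite (parcs G)" by (meson finite_SigmaI finite_subset)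
  with * show "pair_graph G"
    by unfold_locales (auto simp: symmetric_def irrefl_def)
qed

lemma pair_graph_graph_of:
  assumes "finite V" "E \<subseteq> V \<times> V" "irrefl E"
  shows "pair_graph (graph_of V E)"
  using assms by (auto simp: pair_graph_iff irrefl_def sym_def)

lemma pair_graph_union:
  "pair_graph G \<Longrightarrow> pair_graph H \<Longrightarrow> pair_graph (graph_union G H)"
  by (auto simp: pair_graph_iff irrefl_def sym_def)

lemma finite_closed_nbhd: "pair_graph G \<Longrightarrow> finite (closed_nbhd G v)"
  by (rule finite_subset[of _ "insert v (pverts G)"])
     (auto simp: pair_graph_iff closed_nbhd_def nbhd_def)

lemma closed_nbhd_subset: "pair_graph G \<Longrightarrow> v \<in> pverts G \<Longrightarrow> closed_nbhd G v \<subseteq> pverts G"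
  by (auto simp: pair_graph_iff closed_nbhd_def nbhd_def)

lemma edges_graph_union: "edges (graph_union G H) = edges G \<union> edges H"
  by (auto simp: edges_def)

lemma edge_subset: "pair_graph G \<Longrightarrow> e \<in> edges G \<Longrightarrow> e \<subseteq> pverts G"
  by (auto simp: edges_def pair_graph_iff)

lemma finite_edges: "pair_graph G \<Longrightarrow> finite (edges G)"
  by (rule finite_subset[of _ "Pow (pverts G)"])
     (auto simp: edge_subset pair_graph_iff, auto simp: edges_def)

section \<open>Straight-line drawings\<close>

text \<open>
  Twice the signed area of the triangle \<open>a b c\<close>: positive when the triple turns counterclockwise,
  zero when the points are collinear. The ring is a parameter so that the same expression can be
  computed on integer points and used on real ones.
\<close>

definition orient :: "'r::comm_ring \<times> 'r \<Rightarrow> 'r \<times> 'r \<Rightarrow> 'r \<times> 'r \<Rightarrow> 'r" where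
  "orient a b c = (fst b - fst a) * (snd c - snd a) - (snd b - snd a) * (fst c - fst a)"

text \<open>
  A sufficient condition for the straight-line drawing to be plane: general position of the vertices
  keeps every edge away from the other vertices and separates edges with a common end; for two edges
  without a common end it is demanded that the line through one of them has the other edge
  strictly on one side.
\<close>

definition crossing_free :: "'a set \<Rightarrow> ('a \<times> 'a) set \<Rightarrow> ('a \<Rightarrow> int \<times> int) \<Rightarrow> bool" where
  "crossing_free V E q \<longleftrightarrow>
     (\<forall>a\<in>V. \<forall>b\<in>V. \<forall>c\<in>V. distinct [a, b, c] \<longrightarrow> orient (q a) (q b) (q c) \<noteq> 0) \<and>
     (\<forall>(a, b)\<in>E. \<forall>(c, d)\<in>E. distinct [a, b, c, d] \<longrightarrow>
        orient (q a) (q b) (q c) * orient (q a) (q b) (q d) > 0 \<or>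
        orient (q c) (q d) (q a) * orient (q c) (q d) (q b) > 0)"

text \<open>
  As a function of the third point this is affine and vanishes on the line through the first two,
  so its sign tells on which side of the line a point lies.
\<close>

definition side :: "real ^ 2 \<Rightarrow> real ^ 2 \<Rightarrow> real ^ 2 \<Rightarrow> real" where
  "side a b x = orient (a $ 1, a $ 2) (b $ 1, b $ 2) (x $ 1, x $ 2)"

lemma side_affine: "side a b ((1 - t) *\<^sub>R x + t *\<^sub>R y) = (1 - t) * side a b x + t * side a b y"
  by (simp add: side_def orient_def algebra_simps)

lemma side_self [simp]: "side a b a = 0" "side a b b = 0"
  by (simp_all add: side_def orient_def)

lemma side_closed_segment_self: "x \<in> closed_segment a b \<Longrightarrow> side a b x = 0"
  by (auto simp: in_segment side_affine)

text \<open>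
  The open half-planes of a line are convex.
\<close>

lemma side_closed_segment_pos:
  assumes "side a b c * side a b d > 0" "x \<in> closed_segment c d"
  shows "side a b x \<noteq> 0"
proof -
  obtain t where t: "0 \<le> t" "t \<le> 1" "x = (1 - t) *\<^sub>R c + t *\<^sub>R d"
    using assms(2) by (auto simp: in_segment)
  have "(1 - t) * u + t * v > 0" if "u > 0" "v > 0" for u v :: real
  proof (cases "t = 0")
    case False
    then show ?thesis using that t by (intro add_nonneg_pos) auto
  qed (use that in auto)
  from this[of "side a b c" "side a b d"] this[of "- side a b c" "- side a b d"] assms(1)
  show ?thesis unfolding t(3) side_affine by (auto simp: zero_less_mult_iff)
qed

lemma closed_segments_disjoint:
  assumes "side a b c * side a b d > 0"
  shows "closed_segment a b \<inter> closed_segment c d = {}"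
  using side_closed_segment_pos[OF assms] side_closed_segment_self[of _ a b] by blast

text \<open>
  A point \<open>(1 - t) a + t c\<close> of the second segment has \<open>side\<close> equal to \<open>t\<close> times that of \<open>c\<close>; on the
  first segment this is zero, which forces \<open>t = 0\<close>.
\<close>

lemma closed_segments_common_endpoint:
  assumes "side a b c \<noteq> 0"
  shows "closed_segment a b \<inter> closed_segment a c = {a}"
proof -
  have "x = a" if ab: "x \<in> closed_segment a b" and ac: "x \<in> closed_segment a c" for x
  proof -
    obtain t where t: "x = (1 - t) *\<^sub>R a + t *\<^sub>R c" using ac by (auto simp: in_segment)
    have "t * side a b c = 0"
      using side_closed_segment_self[OF ab] unfolding t side_affine by simp
    then show ?thesis using t assms by simp
  qed
  then show ?thesis by auto
qed

text \<open>
  Since all conditions in \<open>crossing_free\<close> concern integers, the planarity of a concrete graph is reduced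
  to a computation.
\<close>

lemma planar_straight_line:
  assumes G: "pair_graph (graph_of V E)" and cf: "crossing_free V E q" and inj: "inj_on q V"
  shows "planar (graph_of V E)"
proof -
  let ?G = "graph_of V E"
  define p :: "'a \<Rightarrow> real ^ 2"
    where "p v = vector [of_int (fst (q v)), of_int (snd (q v))]" for v
  \<comment> \<open>An edge is an unordered pair, so one of its orientations has to be chosen; the image of the
    segment does not depend on this choice.\<close>
  define \<gamma> where "\<gamma> e = (SOME g. \<exists>u v. (u, v) \<in> E \<and> e = {u, v} \<and> g = linepath (p u) (p v))" for e
  have E: "a \<in> V" "b \<in> V" "a \<noteq> b" if "(a, b) \<in> E" for a b
    using that G by (auto simp: pair_graph_iff irrefl_def)
  have side_p: "side (p a) (p b) (p c) = of_int (orient (q a) (q b) (q c))" for a b c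
    by (simp add: side_def p_def orient_def)
  have p_inj: "inj_on p V"
    using inj by (auto simp: inj_on_def p_def vec_eq_iff forall_2 prod_eq_iff)
  have gp: "side (p a) (p b) (p c) \<noteq> 0"
    if "a \<in> V" "b \<in> V" "c \<in> V" "a \<noteq> b" "a \<noteq> c" "b \<noteq> c" for a b c
    using cf that unfolding crossing_free_def side_p by auto
  have disj: "closed_segment (p a) (p b) \<inter> closed_segment (p c) (p d) = {}"
    if "(a, b) \<in> E" "(c, d) \<in> E" "distinct [a, b, c, d]" for a b c d
  proof -
    have "orient (q a) (q b) (q c) * orient (q a) (q b) (q d) > 0 \<or>
        orient (q c) (q d) (q a) * orient (q c) (q d) (q b) > 0"
      using cf that unfolding crossing_free_def by blast
    then have "side (p a) (p b) (p c) * side (p a) (p b) (p d) > 0 \<or>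
        side (p c) (p d) (p a) * side (p c) (p d) (p b) > 0"
      unfolding side_p of_int_mult[symmetric] of_int_0_less_iff .
    then show ?thesis using closed_segments_disjoint by blast
  qed
  have rep: "\<exists>u v. (u, v) \<in> E \<and> e = {u, v} \<and> \<gamma> e = linepath (p u) (p v)" if "e \<in> edges ?G" for e
  proof -
    have "\<exists>g u v. (u, v) \<in> E \<and> e = {u, v} \<and> g = linepath (p u) (p v)"
      using that unfolding edges_def by auto
    from someI_ex[OF this] show ?thesis unfolding \<gamma>_def .
  qed
  have edge: "arc (\<gamma> e) \<and> {pathstart (\<gamma> e), pathfinish (\<gamma> e)} = p ` e \<and>
      path_image (\<gamma> e) \<inter> p ` V = p ` e" if "e \<in> edges ?G" for e
  proof -
    obtain u v where uv: "(u, v) \<in> E" "e = {u, v}" "\<gamma> e = linepath (p u) (p v)"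
      using rep[OF \<open>e \<in> edges ?G\<close>] by blast
    have "p u \<noteq> p v" using E[OF uv(1)] p_inj by (auto simp: inj_on_def)
    moreover have "w = u \<or> w = v" if "w \<in> V" "p w \<in> closed_segment (p u) (p v)" for w
      using gp[of u v w] side_closed_segment_self[OF that(2)] E[OF uv(1)] that(1) by auto
    ultimately show ?thesis using uv E[OF uv(1)] by auto
  qed
  have pair: "path_image (\<gamma> e) \<inter> path_image (\<gamma> e') = p ` (e \<inter> e')"
    if e: "e \<in> edges ?G" "e' \<in> edges ?G" "e \<noteq> e'" for e e'
  proof -
    obtain a b where ab: "(a, b) \<in> E" "e = {a, b}" "\<gamma> e = linepath (p a) (p b)"
      using rep[OF e(1)] by blast
    obtain c d where cd: "(c, d) \<in> E" "e' = {c, d}" "\<gamma> e' = linepath (p c) (p d)"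
      using rep[OF e(2)] by blast
    note V = E[OF ab(1)] E[OF cd(1)]
    note com = closed_segments_common_endpoint[OF gp]
    consider "distinct [a, b, c, d]" | "a = c" "b \<noteq> d" | "a = d" "b \<noteq> c"
      | "b = c" "a \<noteq> d" | "b = d" "a \<noteq> c"
      using V e(3) ab(2) cd(2) by auto
    then show ?thesis
    proof cases
      case 1
      then show ?thesis using disj[OF ab(1) cd(1)] ab cd by auto
    next
      case 2
      then show ?thesis using com[of a b d] ab cd V by auto
    next
      case 3
      then show ?thesis using com[of a b c] ab cd V by (auto simp: closed_segment_commute)
    next
      case 4
      then show ?thesis using com[of b a d] ab cd V by (auto simp: closed_segment_commute)
    next
      case 5
      then show ?thesis using com[of b a c] ab cd V by (auto simp: closed_segment_commute)
    qed
  qed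
  have "plane_drawing ?G p \<gamma>"
    unfolding plane_drawing_def using p_inj edge pair by auto
  then show ?thesis unfolding planar_def by blast
qed

section \<open>Planarity of disjoint unions\<close>

definition drawing_support ::
    "'a pair_pre_digraph \<Rightarrow> ('a \<Rightarrow> real ^ 2) \<Rightarrow> ('a set \<Rightarrow> real \<Rightarrow> real ^ 2) \<Rightarrow> (real ^ 2) set" where
  "drawing_support G p \<gamma> = p ` pverts G \<union> (\<Union>e\<in>edges G. path_image (\<gamma> e))"

lemma bounded_drawing_support:
  assumes "pair_graph G" "plane_drawing G p \<gamma>"
  shows "bounded (drawing_support G p \<gamma>)"
proof -
  have "bounded (path_image (\<gamma> e))" if "e \<in> edges G" for e
    using assms(2) that by (simp add: plane_drawing_def bounded_arc_image)
  then show ?thesis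
    unfolding drawing_support_def using assms(1) finite_edges[OF assms(1)]
    by (auto simp: pair_graph_iff finite_imp_bounded)
qed

lemma plane_drawing_translate:
  assumes "plane_drawing G p \<gamma>"
  shows "plane_drawing G ((+) c \<circ> p) (\<lambda>e. (+) c \<circ> \<gamma> e)"
proof -
  have [simp]: "arc ((+) c \<circ> g) \<longleftrightarrow> arc g" "path_image ((+) c \<circ> g) = (+) c ` path_image g"
      "{pathstart ((+) c \<circ> g), pathfinish ((+) c \<circ> g)} = (+) c ` {pathstart g, pathfinish g}"
    for g :: "real \<Rightarrow> real ^ 2"
    by (simp_all add: arc_translation_eq path_image_compose pathstart_compose pathfinish_compose)
  have [simp]: "(\<lambda>x. c + p x) ` A = (+) c ` p ` A" for A by (simp add: image_image)
  have [simp]: "(+) c ` A \<inter> (+) c ` B = (+) c ` (A \<inter> B)" for A B by (simp add: image_Int)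
  have "inj_on ((+) c \<circ> p) (pverts G)"
    using assms by (simp add: plane_drawing_def inj_on_def)
  then show ?thesis
    using assms unfolding plane_drawing_def by simp
qed

text \<open>
  If the two drawings occupy disjoint parts of the plane, drawing both at once creates no new
  incidences.
\<close>

lemma plane_drawing_union:
  assumes G: "pair_graph G" and H: "pair_graph H" and V: "pverts G \<inter> pverts H = {}"
    and dG: "plane_drawing G p \<gamma>" and dH: "plane_drawing H q \<delta>"
    and disj: "drawing_support G p \<gamma> \<inter> drawing_support H q \<delta> = {}"
  shows "plane_drawing (graph_union G H) (\<lambda>v. if v \<in> pverts G then p v else q v)
           (\<lambda>e. if e \<in> edges G then \<gamma> e else \<delta> e)"
    (is "plane_drawing _ ?p ?\<gamma>")
proof -
  have pG: "?p ` A = p ` A" if "A \<subseteq> pverts G" for A using that by (intro image_cong) auto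
  have pH: "?p ` A = q ` A" if "A \<subseteq> pverts H" for A using that V by (intro image_cong) auto
  have eG: "e \<subseteq> pverts G" "?p ` e = p ` e" "?\<gamma> e = \<gamma> e" "path_image (\<gamma> e) \<subseteq> drawing_support G p \<gamma>"
    if "e \<in> edges G" for e
    using that edge_subset[OF G that] pG by (auto simp: drawing_support_def)
  have eH: "e \<subseteq> pverts H" "?p ` e = q ` e" "?\<gamma> e = \<delta> e" "path_image (\<delta> e) \<subseteq> drawing_support H q \<delta>"
    if "e \<in> edges H" for e
  proof -
    show eV: "e \<subseteq> pverts H" using edge_subset[OF H that] .
    show "?p ` e = q ` e" using pH[OF eV] .
    have "e \<noteq> {}" using that by (auto simp: edges_def)
    then have "e \<notin> edges G" using eV edge_subset[OF G, of e] V by blast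
    then show "?\<gamma> e = \<delta> e" by simp
    show "path_image (\<delta> e) \<subseteq> drawing_support H q \<delta>" using that by (auto simp: drawing_support_def)
  qed
  have vG: "p ` pverts G \<subseteq> drawing_support G p \<gamma>" and vH: "q ` pverts H \<subseteq> drawing_support H q \<delta>"
    by (auto simp: drawing_support_def)
  have im: "?p ` pverts (graph_union G H) = p ` pverts G \<union> q ` pverts H"
    unfolding pverts_graph_union image_Un pG[OF subset_refl] pH[OF subset_refl] ..
  have "inj_on ?p (pverts G \<union> pverts H)"
  proof (subst inj_on_Un, intro conjI)
    show "inj_on ?p (pverts G)" using dG by (auto simp: plane_drawing_def inj_on_def)
    show "inj_on ?p (pverts H)" using dH V by (auto simp: plane_drawing_def inj_on_def)
    show "?p ` (pverts G - pverts H) \<inter> ?p ` (pverts H - pverts G) = {}"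
      using disj vG vH by (auto 0 3)
  qed
  moreover have "arc (?\<gamma> e) \<and> {pathstart (?\<gamma> e), pathfinish (?\<gamma> e)} = ?p ` e \<and>
      path_image (?\<gamma> e) \<inter> ?p ` pverts (graph_union G H) = ?p ` e"
    if "e \<in> edges G \<union> edges H" for e
    using that
  proof
    assume e: "e \<in> edges G"
    have "path_image (\<gamma> e) \<inter> p ` pverts G = p ` e" "arc (\<gamma> e)"
        "{pathstart (\<gamma> e), pathfinish (\<gamma> e)} = p ` e"
      using dG e by (simp_all add: plane_drawing_def)
    moreover have "path_image (\<gamma> e) \<inter> q ` pverts H = {}"
      using eG(4)[OF e] disj vH by blast
    ultimately show ?thesis unfolding im eG[OF e] Int_Un_distrib by simp
  next
    assume e: "e \<in> edges H"
    have "path_image (\<delta> e) \<inter> q ` pverts H = q ` e" "arc (\<delta> e)"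
        "{pathstart (\<delta> e), pathfinish (\<delta> e)} = q ` e"
      using dH e by (simp_all add: plane_drawing_def)
    moreover have "path_image (\<delta> e) \<inter> p ` pverts G = {}"
      using eH(4)[OF e] disj vG by blast
    ultimately show ?thesis unfolding im eH[OF e] Int_Un_distrib by simp
  qed
  moreover have "path_image (?\<gamma> e) \<inter> path_image (?\<gamma> e') = ?p ` (e \<inter> e')"
    if "e \<in> edges G \<union> edges H" "e' \<in> edges G \<union> edges H" "e \<noteq> e'" for e e'
  proof -
    consider "e \<in> edges G" "e' \<in> edges G" | "e \<in> edges H" "e' \<in> edges H"
      | "e \<in> edges G" "e' \<in> edges H" | "e \<in> edges H" "e' \<in> edges G"
      using \<open>e \<in> edges G \<union> edges H\<close> \<open>e' \<in> edges G \<union> edges H\<close> by blast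
    then show ?thesis
    proof cases
      case 1
      then have "path_image (\<gamma> e) \<inter> path_image (\<gamma> e') = p ` (e \<inter> e')"
        using dG \<open>e \<noteq> e'\<close> by (simp add: plane_drawing_def)
      then show ?thesis using 1 eG(1)[OF 1(1)] pG[of "e \<inter> e'"] by auto
    next
      case 2
      then have "path_image (\<delta> e) \<inter> path_image (\<delta> e') = q ` (e \<inter> e')"
        using dH \<open>e \<noteq> e'\<close> by (simp add: plane_drawing_def)
      moreover have "?p ` (e \<inter> e') = q ` (e \<inter> e')" using eH(1)[OF 2(1)] by (intro pH) auto
      ultimately show ?thesis unfolding eH(3)[OF 2(1)] eH(3)[OF 2(2)] by simp
    next
      case 3
      have "e \<inter> e' = {}" using eG(1)[OF 3(1)] eH(1)[OF 3(2)] V by auto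
      then show ?thesis unfolding eG(3)[OF 3(1)] eH(3)[OF 3(2)]
        using eG(4)[OF 3(1)] eH(4)[OF 3(2)] disj by auto
    next
      case 4
      have "e \<inter> e' = {}" using eG(1)[OF 4(2)] eH(1)[OF 4(1)] V by auto
      then show ?thesis unfolding eG(3)[OF 4(2)] eH(3)[OF 4(1)]
        using eG(4)[OF 4(2)] eH(4)[OF 4(1)] disj by auto
    qed
  qed
  ultimately show ?thesis
    unfolding plane_drawing_def by (auto simp: edges_graph_union)
qed

text \<open>
  A drawing of a finite graph is compact, hence bounded, so a translation by a long enough vector
  moves one drawing off the other.
\<close>

lemma planar_union:
  assumes G: "pair_graph G" and H: "pair_graph H" and V: "pverts G \<inter> pverts H = {}"
    and "planar G" "planar H"
  shows "planar (graph_union G H)"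
proof -
  obtain p \<gamma> q \<delta> where dG: "plane_drawing G p \<gamma>" and dH: "plane_drawing H q \<delta>"
    using assms by (auto simp: planar_def)
  obtain r s where r: "\<And>x. x \<in> drawing_support G p \<gamma> \<Longrightarrow> norm x < r"
    and s: "\<And>x. x \<in> drawing_support H q \<delta> \<Longrightarrow> norm x < s"
    using bounded_drawing_support[OF G dG] bounded_drawing_support[OF H dH]
    by (meson bounded_pos_less)
  obtain c :: "real ^ 2" where c: "norm c = max 0 (r + s)"
    using vector_choose_size[of "max 0 (r + s)"] by auto
  have "drawing_support H ((+) c \<circ> q) (\<lambda>e. (+) c \<circ> \<delta> e) = (+) c ` drawing_support H q \<delta>"
    by (simp add: drawing_support_def path_image_compose image_Un image_UN image_comp)
  moreover have "c + x \<notin> drawing_support G p \<gamma>" if "x \<in> drawing_support H q \<delta>" for x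
    using r[of "c + x"] s[OF that] c norm_diff_ineq[of c x] by auto
  ultimately have "drawing_support G p \<gamma> \<inter>
      drawing_support H ((+) c \<circ> q) (\<lambda>e. (+) c \<circ> \<delta> e) = {}"
    by auto
  from plane_drawing_union[OF G H V dG plane_drawing_translate[OF dH] this]
  show ?thesis unfolding planar_def by blast
qed

section \<open>Odd domination and odd-sum colourings of disjoint unions\<close>

lemma closed_nbhd_union:
  assumes "pair_graph G" "pair_graph H" "pverts G \<inter> pverts H = {}"
  shows "v \<in> pverts G \<Longrightarrow> closed_nbhd (graph_union G H) v = closed_nbhd G v"
    and "v \<in> pverts H \<Longrightarrow> closed_nbhd (graph_union G H) v = closed_nbhd H v"
  using assms by (auto simp: closed_nbhd_def nbhd_def pair_graph_iff)

lemma odd_dominating_union_iff: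
  assumes "pair_graph G" "pair_graph H" "pverts G \<inter> pverts H = {}"
  shows "odd_dominating (graph_union G H) D \<longleftrightarrow>
    D \<subseteq> pverts G \<union> pverts H \<and> odd_dominating G (D \<inter> pverts G) \<and> odd_dominating H (D \<inter> pverts H)"
proof -
  have "closed_nbhd G v \<inter> (D \<inter> pverts G) = closed_nbhd G v \<inter> D" if "v \<in> pverts G" for v
    using closed_nbhd_subset[OF assms(1) that] by auto
  moreover have "closed_nbhd H v \<inter> (D \<inter> pverts H) = closed_nbhd H v \<inter> D" if "v \<in> pverts H" for v
    using closed_nbhd_subset[OF assms(2) that] by auto
  ultimately show ?thesis
    using closed_nbhd_union[OF assms] by (auto simp: odd_dominating_def ball_Un)
qed

text \<open>
  Splitting an odd-dominating set into its traces on the two parts is a bijection, since closed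
  neighbourhoods never cross between the parts.
\<close>

lemma ods_union:
  assumes "pair_graph G" "pair_graph H" "pverts G \<inter> pverts H = {}"
  shows "ods (graph_union G H) = ods G * ods H"
proof -
  have GV: "A \<subseteq> pverts G" if "odd_dominating G A" for A using that by (simp add: odd_dominating_def)
  have HV: "A \<subseteq> pverts H" if "odd_dominating H A" for A using that by (simp add: odd_dominating_def)
  have "bij_betw (\<lambda>D. (D \<inter> pverts G, D \<inter> pverts H)) {D. odd_dominating (graph_union G H) D}
     ({D. odd_dominating G D} \<times> {D. odd_dominating H D})"
  proof (rule bij_betw_byWitness[where f' = "\<lambda>(A, B). A \<union> B"])
    show "\<forall>D\<in>{D. odd_dominating (graph_union G H) D}.
        (case (D \<inter> pverts G, D \<inter> pverts H) of (A, B) \<Rightarrow> A \<union> B) = D"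
      by (auto simp: odd_dominating_union_iff[OF assms])
    have *: "(A \<union> B) \<inter> pverts G = A" "(A \<union> B) \<inter> pverts H = B"
      if "odd_dominating G A" "odd_dominating H B" for A B
      using GV[OF that(1)] HV[OF that(2)] assms(3) by auto
    then show "\<forall>a'\<in>{D. odd_dominating G D} \<times> {D. odd_dominating H D}.
       ((case a' of (A, B) \<Rightarrow> A \<union> B) \<inter> pverts G, (case a' of (A, B) \<Rightarrow> A \<union> B) \<inter> pverts H) = a'"
      by auto
    show "(\<lambda>D. (D \<inter> pverts G, D \<inter> pverts H)) ` {D. odd_dominating (graph_union G H) D}
       \<subseteq> {D. odd_dominating G D} \<times> {D. odd_dominating H D}"
      by (auto simp: odd_dominating_union_iff[OF assms])
    show "(\<lambda>(A, B). A \<union> B) ` ({D. odd_dominating G D} \<times> {D. odd_dominating H D})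
       \<subseteq> {D. odd_dominating (graph_union G H) D}"
      using GV HV by (auto simp: odd_dominating_union_iff[OF assms] *)
  qed
  then show ?thesis unfolding ods_def by (simp add: bij_betw_same_card card_cartesian_product)
qed

lemma odd_sum_coloring_union:
  assumes G: "pair_graph G" and H: "pair_graph H" and V: "pverts G \<inter> pverts H = {}"
    and f: "odd_sum_coloring G f" and g: "odd_sum_coloring H g"
  shows "odd_sum_coloring (graph_union G H) (\<lambda>v. if v \<in> pverts G then f v else g v)"
proof -
  have "(\<Sum>w\<in>closed_nbhd G v. if w \<in> pverts G then f w else g w) = (\<Sum>w\<in>closed_nbhd G v. f w)"
    if "v \<in> pverts G" for v
    using closed_nbhd_subset[OF G that] by (intro sum.cong) auto
  moreover have "(\<Sum>w\<in>closed_nbhd H v. if w \<in> pverts G then f w else g w) = (\<Sum>w\<in>closed_nbhd H v. g w)"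
    if "v \<in> pverts H" for v
    using closed_nbhd_subset[OF H that] V by (intro sum.cong) auto
  moreover have "coloring (graph_union G H) (\<lambda>v. if v \<in> pverts G then f v else g v)"
  proof -
    have "f v \<noteq> f w" "v \<in> pverts G" "w \<in> pverts G" if "(v, w) \<in> parcs G" for v w
      using that f G by (auto simp: odd_sum_coloring_def coloring_def pair_graph_iff)
    moreover have "g v \<noteq> g w" "v \<notin> pverts G" "w \<notin> pverts G" if "(v, w) \<in> parcs H" for v w
      using that g H V by (auto simp: odd_sum_coloring_def coloring_def pair_graph_iff)
    moreover have "\<forall>v\<in>pverts G. f v > 0" "\<forall>v\<in>pverts H. g v > 0"
      using f g by (simp_all add: odd_sum_coloring_def coloring_def)
    ultimately show ?thesis unfolding coloring_def by auto
  qed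
  ultimately show ?thesis
    using f g closed_nbhd_union[OF G H V] by (auto simp: odd_sum_coloring_def)
qed

text \<open>
  A sum of natural numbers has the parity of the number of its odd summands.
\<close>

lemma odd_dominating_odd_colors:
  assumes "pair_graph G" "odd_sum_coloring G f"
  shows "odd_dominating G {v \<in> pverts G. odd (f v)}"
proof -
  have "odd (card (closed_nbhd G x \<inter> {v \<in> pverts G. odd (f v)}))" if x: "x \<in> pverts G" for x
  proof -
    have "closed_nbhd G x \<inter> {v \<in> pverts G. odd (f v)} = {v \<in> closed_nbhd G x. odd (f v)}"
      using closed_nbhd_subset[OF assms(1) x] by auto
    moreover have "odd (\<Sum>w\<in>closed_nbhd G x. f w)"
      using assms(2) x by (simp add: odd_sum_coloring_def)
    ultimately show ?thesis
      using even_sum_iff[OF finite_closed_nbhd[OF assms(1)], of f x] by simp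
  qed
  then show ?thesis by (auto simp: odd_dominating_def)
qed

lemma coloring_graph_of:
  "coloring (graph_of V E) f \<longleftrightarrow> (\<forall>v\<in>V. f v > 0) \<and> (\<forall>(v, w)\<in>E. f v \<noteq> f w)"
proof
  assume "coloring (graph_of V E) f"
  then show "(\<forall>v\<in>V. f v > 0) \<and> (\<forall>(v, w)\<in>E. f v \<noteq> f w)" by (auto simp: coloring_def)
next
  assume f: "(\<forall>v\<in>V. f v > 0) \<and> (\<forall>(v, w)\<in>E. f v \<noteq> f w)"
  have "f v \<noteq> f w" if "(v, w) \<in> E \<union> E\<inverse>" for v w
    using that
  proof
    assume "(v, w) \<in> E" then show ?thesis using f by auto
  next
    assume "(v, w) \<in> E\<inverse>"
    then have "f w \<noteq> f v" using f by auto
    then show ?thesis by simp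
  qed
  then show "coloring (graph_of V E) f" using f unfolding coloring_def by auto
qed

lemma inj_on_clique: "coloring G f \<Longrightarrow> clique G K \<Longrightarrow> inj_on f K"
  by (fastforce simp: coloring_def clique_def inj_on_def)

text \<open>
  The source of all lower bounds here: a clique of vertices forced to be odd and a clique of vertices
  forced to be even are each coloured injectively, and they share no colour.
\<close>

lemma card_colors_ge:
  assumes G: "pair_graph G" and f: "odd_sum_coloring G f"
    and A: "clique G A" and B: "clique G B"
    and forced: "\<And>D. odd_dominating G D \<Longrightarrow> A \<subseteq> D \<and> B \<inter> D = {}"
  shows "card A + card B \<le> card (f ` pverts G)"
proof -
  have col: "coloring G f" using f by (simp add: odd_sum_coloring_def)
  have AB: "A \<subseteq> pverts G" "B \<subseteq> pverts G" using A B by (auto simp: clique_def)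
  have fin: "finite (pverts G)" using G by (simp add: pair_graph_iff)
  have "\<forall>v\<in>A. odd (f v)" "\<forall>v\<in>B. even (f v)"
    using forced[OF odd_dominating_odd_colors[OF G f]] AB by auto
  then have "f ` A \<inter> f ` B = {}" by force
  then have "card (f ` A \<union> f ` B) = card A + card B"
    using AB fin inj_on_clique[OF col A] inj_on_clique[OF col B]
    by (subst card_Un_disjoint) (auto simp: card_image finite_subset)
  moreover have "card (f ` A \<union> f ` B) \<le> card (f ` pverts G)"
    using AB fin by (intro card_mono) auto
  ultimately show ?thesis by simp
qed

section \<open>The building blocks\<close>

text \<open>
  Used as a rewrite rule, this turns the parity condition at a vertex into a linear equation over
  the field with two elements for the membership of its closed neighbours, with inequality of truth
  values in the role of addition.
\<close>

lemma even_card_insert_Int: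
  assumes "finite A" "x \<notin> A"
  shows "even (card (insert x A \<inter> D)) \<longleftrightarrow> (x \<in> D) \<noteq> even (card (A \<inter> D))"
  using assms by (simp add: Int_insert_left)

text \<open>
  A \<open>K\<^sub>4\<close> on \<open>0, 1, 2, 3\<close> that receives only odd colours. Vertex \<open>4\<close> is joined to \<open>0, 1\<close> and vertex \<open>5\<close> to
  \<open>2, 3\<close>, which makes the set of the vertices \<open>0, ..., 5\<close> odd-dominating; the leaves \<open>6\<close> and \<open>7\<close> make
  it the only odd-dominating set.
\<close>

definition odd_gadget_edges :: "(nat \<times> nat) set" where
  "odd_gadget_edges = set [(0,1), (0,2), (0,3), (1,2), (1,3), (2,3), (0,4), (1,4), (2,5), (3,5), (0,6), (2,7)]"

definition odd_gadget :: "nat pair_pre_digraph" where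
  "odd_gadget = graph_of (set [0,1,2,3,4,5,6,7]) odd_gadget_edges"

text \<open>
  A \<open>K\<^sub>4\<close> on \<open>8, 9, 10, 11\<close> that receives only even colours, with one leaf at each of its vertices.
\<close>

definition even_gadget_edges :: "(nat \<times> nat) set" where
  "even_gadget_edges = set [(8,9), (8,10), (8,11), (9,10), (9,11), (10,11), (8,12), (9,13), (10,14), (11,15)]"

definition even_gadget :: "nat pair_pre_digraph" where
  "even_gadget = graph_of (set [8,9,10,11,12,13,14,15]) even_gadget_edges"

definition triangle_on :: "nat \<Rightarrow> nat pair_pre_digraph" where
  "triangle_on n = graph_of {n, n + 1, n + 2} {(n, n + 1), (n, n + 2), (n + 1, n + 2)}"

lemma pverts_odd_gadget: "pverts odd_gadget = {0, 1, 2, 3, 4, 5, 6, 7}"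
  by (simp add: odd_gadget_def)

lemma pverts_even_gadget: "pverts even_gadget = {8, 9, 10, 11, 12, 13, 14, 15}"
  by (simp add: even_gadget_def)

lemma pverts_triangle: "pverts (triangle_on n) = {n, n + 1, n + 2}"
  by (simp add: triangle_on_def)

lemma pair_graph_odd_gadget: "pair_graph odd_gadget"
  unfolding odd_gadget_def odd_gadget_edges_def by (rule pair_graph_graph_of) (auto simp: irrefl_def)

lemma pair_graph_even_gadget: "pair_graph even_gadget"
  unfolding even_gadget_def even_gadget_edges_def by (rule pair_graph_graph_of) (auto simp: irrefl_def)

lemma pair_graph_triangle: "pair_graph (triangle_on n)"
  unfolding triangle_on_def by (rule pair_graph_graph_of) (auto simp: irrefl_def)

lemma planar_odd_gadget: "planar odd_gadget"
proof -
  let ?q = "\<lambda>v::nat. [(4, 0), (3, 1), (5, 4), (1, 1), (4, 2), (2, 3), (6, 2), (5, 6)] ! v :: int \<times> int"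
  have "crossing_free (set [0,1,2,3,4,5,6,7]) odd_gadget_edges ?q"
    unfolding crossing_free_def orient_def odd_gadget_edges_def by code_simp
  moreover have "inj_on ?q (set [0,1,2,3,4,5,6,7])" unfolding inj_on_def by code_simp
  ultimately show ?thesis
    using pair_graph_odd_gadget unfolding odd_gadget_def by (intro planar_straight_line)
qed

lemma planar_even_gadget: "planar even_gadget"
proof -
  let ?q = "\<lambda>v::nat. [(2, 4), (3, 2), (0, 0), (4, 1), (1, 3), (1, 1), (3, 0), (4, 3)] ! (v - 8) :: int \<times> int"
  have "crossing_free (set [8,9,10,11,12,13,14,15]) even_gadget_edges ?q"
    unfolding crossing_free_def orient_def even_gadget_edges_def by code_simp
  moreover have "inj_on ?q (set [8,9,10,11,12,13,14,15])" unfolding inj_on_def by code_simp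
  ultimately show ?thesis
    using pair_graph_even_gadget unfolding even_gadget_def by (intro planar_straight_line)
qed

lemma planar_triangle: "planar (triangle_on n)"
proof -
  have "planar (graph_of {a, b, c} {(a, b), (a, c), (b, c)})"
    if "a \<noteq> b" "a \<noteq> c" "b \<noteq> c" for a b c :: nat
  proof -
    define q :: "nat \<Rightarrow> int \<times> int"
      where "q v = (if v = a then (0, 0) else if v = b then (1, 0) else (0, 1))" for v
    have q: "q a = (0, 0)" "q b = (1, 0)" "q c = (0, 1)"
      using that by (simp_all add: q_def)
    have "crossing_free {a, b, c} {(a, b), (a, c), (b, c)} q"
      using that by (simp add: crossing_free_def orient_def q)
    moreover have "inj_on q {a, b, c}" by (auto simp: inj_on_def q)
    moreover have "pair_graph (graph_of {a, b, c} {(a, b), (a, c), (b, c)})"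
      using that by (intro pair_graph_graph_of) (auto simp: irrefl_def)
    ultimately show ?thesis by (intro planar_straight_line)
  qed
  from this[of n "n + 1" "n + 2"] show ?thesis by (simp add: triangle_on_def)
qed

lemma closed_nbhd_odd_gadget:
  "closed_nbhd odd_gadget 0 = {0, 1, 2, 3, 4, 6}" "closed_nbhd odd_gadget 1 = {0, 1, 2, 3, 4}"
  "closed_nbhd odd_gadget 2 = {0, 1, 2, 3, 5, 7}" "closed_nbhd odd_gadget 3 = {0, 1, 2, 3, 5}"
  "closed_nbhd odd_gadget 4 = {0, 1, 4}" "closed_nbhd odd_gadget 5 = {2, 3, 5}"
  "closed_nbhd odd_gadget 6 = {0, 6}" "closed_nbhd odd_gadget 7 = {2, 7}"
  by (auto simp: closed_nbhd_def nbhd_def odd_gadget_def odd_gadget_edges_def)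

lemma closed_nbhd_even_gadget:
  "closed_nbhd even_gadget 8 = {8, 9, 10, 11, 12}" "closed_nbhd even_gadget 9 = {8, 9, 10, 11, 13}"
  "closed_nbhd even_gadget 10 = {8, 9, 10, 11, 14}" "closed_nbhd even_gadget 11 = {8, 9, 10, 11, 15}"
  "closed_nbhd even_gadget 12 = {8, 12}" "closed_nbhd even_gadget 13 = {9, 13}"
  "closed_nbhd even_gadget 14 = {10, 14}" "closed_nbhd even_gadget 15 = {11, 15}"
  by (auto simp: closed_nbhd_def nbhd_def even_gadget_def even_gadget_edges_def)

lemma closed_nbhd_triangle: "v \<in> {n, n + 1, n + 2} \<Longrightarrow> closed_nbhd (triangle_on n) v = {n, n + 1, n + 2}"
  by (auto simp: closed_nbhd_def nbhd_def triangle_on_def)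

text \<open>
  The closed neighbourhoods of \<open>0\<close> and \<open>1\<close> differ only in the leaf \<open>6\<close>, so \<open>6\<close> is not in \<open>D\<close>, and then
  the condition at the leaf puts \<open>0\<close> into \<open>D\<close>; likewise for \<open>7\<close> and \<open>2\<close>. Now the conditions at \<open>4\<close>
  and \<open>5\<close> say that \<open>4\<close> behaves like \<open>1\<close> and \<open>5\<close> like \<open>3\<close>. With this, the condition at \<open>1\<close> puts
  \<open>3\<close> into \<open>D\<close>, and the condition at \<open>3\<close> puts \<open>1\<close> into \<open>D\<close>.
\<close>

lemma odd_dominating_odd_gadget_iff: "odd_dominating odd_gadget D \<longleftrightarrow> D = {0, 1, 2, 3, 4, 5}"
proof
  note even_card_insert_Int [simp] and Int_insert_left_if0 [simp del] and Int_insert_left_if1 [simp del]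
    and One_nat_def [simp del]
  assume D: "odd_dominating odd_gadget D"
  then have odd: "odd (card (closed_nbhd odd_gadget x \<inter> D))" if "x \<in> pverts odd_gadget" for x
    using that by (simp add: odd_dominating_def)
  note eqs = odd[of 0] odd[of 1] odd[of 2] odd[of 3] odd[of 4] odd[of 5] odd[of 6] odd[of 7]
  note eqs = eqs[unfolded pverts_odd_gadget closed_nbhd_odd_gadget, simplified]
  have "6 \<notin> D" "7 \<notin> D" using eqs(1-4) by argo+
  then have "0 \<in> D" "2 \<in> D" using eqs(7,8) by simp_all
  then have "4 \<in> D \<longleftrightarrow> 1 \<in> D" "5 \<in> D \<longleftrightarrow> 3 \<in> D" using eqs(5,6) by simp_all
  then have "1 \<in> D" "3 \<in> D" "4 \<in> D" "5 \<in> D"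
    using eqs(2,4) \<open>0 \<in> D\<close> \<open>2 \<in> D\<close> by simp_all
  moreover have "D \<subseteq> {0, 1, 2, 3, 4, 5, 6, 7}"
    using D by (simp add: odd_dominating_def pverts_odd_gadget)
  ultimately show "D = {0, 1, 2, 3, 4, 5}"
    using \<open>0 \<in> D\<close> \<open>2 \<in> D\<close> \<open>6 \<notin> D\<close> \<open>7 \<notin> D\<close> by blast
next
  assume "D = {0, 1, 2, 3, 4, 5}"
  then show "odd_dominating odd_gadget D"
    unfolding odd_dominating_def pverts_odd_gadget by (simp add: closed_nbhd_odd_gadget[simplified])
qed

text \<open>
  Exactly one of a vertex of the \<open>K\<^sub>4\<close> and its leaf is in \<open>D\<close>. Hence the condition at a vertex \<open>v\<close> of
  the \<open>K\<^sub>4\<close> says that \<open>v\<close> is in \<open>D\<close> exactly if \<open>D\<close> meets the \<open>K\<^sub>4\<close> in an odd number of vertices. So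
  \<open>D\<close> contains all four or none, and in both cases the number is even: none.
\<close>

lemma odd_dominating_even_gadget_iff: "odd_dominating even_gadget D \<longleftrightarrow> D = {12, 13, 14, 15}"
proof
  note even_card_insert_Int [simp] and Int_insert_left_if0 [simp del] and Int_insert_left_if1 [simp del]
    and One_nat_def [simp del]
  assume D: "odd_dominating even_gadget D"
  then have odd: "odd (card (closed_nbhd even_gadget x \<inter> D))" if "x \<in> pverts even_gadget" for x
    using that by (simp add: odd_dominating_def)
  note eqs = odd[of 8] odd[of 9] odd[of 10] odd[of 11] odd[of 12] odd[of 13] odd[of 14] odd[of 15]
  note eqs = eqs[unfolded pverts_even_gadget closed_nbhd_even_gadget, simplified]
  have "9 \<in> D \<longleftrightarrow> 8 \<in> D" "10 \<in> D \<longleftrightarrow> 8 \<in> D" "11 \<in> D \<longleftrightarrow> 8 \<in> D"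
    using eqs by argo+
  with eqs(1,5) have "8 \<notin> D" by (cases "8 \<in> D") simp_all
  then have "9 \<notin> D" "10 \<notin> D" "11 \<notin> D" "12 \<in> D" "13 \<in> D" "14 \<in> D" "15 \<in> D"
    using eqs(5-8) \<open>9 \<in> D \<longleftrightarrow> 8 \<in> D\<close> \<open>10 \<in> D \<longleftrightarrow> 8 \<in> D\<close> \<open>11 \<in> D \<longleftrightarrow> 8 \<in> D\<close> by simp_all
  moreover have "D \<subseteq> {8, 9, 10, 11, 12, 13, 14, 15}"
    using D by (simp add: odd_dominating_def pverts_even_gadget)
  ultimately show "D = {12, 13, 14, 15}" using \<open>8 \<notin> D\<close> by blast
next
  assume "D = {12, 13, 14, 15}"
  then show "odd_dominating even_gadget D"
    unfolding odd_dominating_def pverts_even_gadget by (simp add: closed_nbhd_even_gadget)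
qed

lemma ods_triangle: "ods (triangle_on n) = 4"
proof -
  have "odd_dominating (triangle_on n) D \<longleftrightarrow> D \<subseteq> {n, n + 1, n + 2} \<and> odd (card D)" for D
  proof -
    have "D \<subseteq> {n, n + 1, n + 2} \<Longrightarrow> {n, n + 1, n + 2} \<inter> D = D" by auto
    then show ?thesis
      unfolding odd_dominating_def pverts_triangle using closed_nbhd_triangle[of _ n] by (metis insertI1)
  qed
  then have "{D. odd_dominating (triangle_on n) D} = {D \<in> Pow {n, n + 1, n + 2}. odd (card D)}" by auto
  also have "\<dots> = {{n}, {n + 1}, {n + 2}, {n, n + 1, n + 2}}"
    by (auto simp: Pow_insert)
  finally show ?thesis by (simp add: ods_def insert_eq_iff)
qed

section \<open>The graphs\<close>

text \<open>
  The gadgets use the vertices below \<open>16\<close>; every triangle takes the next three numbers.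
\<close>

primrec extremal_graph :: "nat \<Rightarrow> nat pair_pre_digraph" where
  "extremal_graph 0 = graph_union odd_gadget even_gadget"
| "extremal_graph (Suc t) = graph_union (extremal_graph t) (triangle_on (16 + 3 * t))"

lemma pverts_extremal: "pverts (extremal_graph t) = {..<16 + 3 * t}"
proof (induction t)
  case 0
  show ?case by (simp add: pverts_odd_gadget pverts_even_gadget lessThan_nat_numeral lessThan_Suc insert_commute)
next
  case (Suc t)
  have "16 + 3 * Suc t = Suc (Suc (Suc (16 + 3 * t)))" by simp
  with Suc show ?case
    by (simp only: extremal_graph.simps pverts_graph_union pverts_triangle lessThan_Suc) auto
qed

lemma disjoint_gadgets: "pverts odd_gadget \<inter> pverts even_gadget = {}"
  by (simp add: pverts_odd_gadget pverts_even_gadget)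

lemma disjoint_extremal_triangle: "pverts (extremal_graph t) \<inter> pverts (triangle_on (16 + 3 * t)) = {}"
  by (simp add: pverts_extremal pverts_triangle)

lemma pair_graph_extremal: "pair_graph (extremal_graph t)"
  by (induction t) (simp_all add: pair_graph_union pair_graph_odd_gadget pair_graph_even_gadget pair_graph_triangle)

lemma planar_extremal: "planar (extremal_graph t)"
  by (induction t)
     (simp_all add: planar_union disjoint_gadgets disjoint_extremal_triangle pair_graph_extremal
       pair_graph_odd_gadget pair_graph_even_gadget pair_graph_triangle planar_odd_gadget planar_even_gadget planar_triangle)

lemma ods_extremal: "ods (extremal_graph t) = 4 ^ t"
proof (induction t)
  case 0
  have "ods (extremal_graph 0) = ods odd_gadget * ods even_gadget"
    by (simp add: ods_union pair_graph_odd_gadget pair_graph_even_gadget disjoint_gadgets)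
  also have "\<dots> = 1" by (simp add: ods_def odd_dominating_odd_gadget_iff odd_dominating_even_gadget_iff)
  finally show ?case by simp
next
  case (Suc t)
  then show ?case
    by (simp add: ods_union pair_graph_extremal pair_graph_triangle disjoint_extremal_triangle ods_triangle)
qed

lemma clique_union:
  "clique G K \<Longrightarrow> clique (graph_union G H) K" "clique H K \<Longrightarrow> clique (graph_union G H) K"
  unfolding clique_def pverts_graph_union parcs_graph_union by auto

lemma extremal_cliques: "clique (extremal_graph t) {0, 1, 2, 3}" "clique (extremal_graph t) {8, 9, 10, 11}"
proof (induction t)
  case 0
  have "clique odd_gadget {0, 1, 2, 3}" "clique even_gadget {8, 9, 10, 11}"
    by (simp_all add: clique_def odd_gadget_def odd_gadget_edges_def even_gadget_def even_gadget_edges_def)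
  then show "clique (extremal_graph 0) {0, 1, 2, 3}" "clique (extremal_graph 0) {8, 9, 10, 11}"
    by (simp_all only: extremal_graph.simps clique_union)
next
  case (Suc t)
  then show "clique (extremal_graph (Suc t)) {0, 1, 2, 3}" "clique (extremal_graph (Suc t)) {8, 9, 10, 11}"
    by (simp_all only: extremal_graph.simps clique_union)
qed

lemma odd_dominating_extremalD:
  "odd_dominating (extremal_graph t) D \<Longrightarrow> {0, 1, 2, 3} \<subseteq> D \<and> {8, 9, 10, 11} \<inter> D = {}"
proof (induction t arbitrary: D)
  case 0
  then have D: "D \<inter> pverts odd_gadget = {0, 1, 2, 3, 4, 5}" "D \<inter> pverts even_gadget = {12, 13, 14, 15}"
    by (simp_all add: odd_dominating_union_iff pair_graph_odd_gadget pair_graph_even_gadget disjoint_gadgets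
        odd_dominating_odd_gadget_iff odd_dominating_even_gadget_iff)
  have "{0, 1, 2, 3} \<subseteq> D \<inter> pverts odd_gadget" unfolding D(1) by simp
  moreover have "{8, 9, 10, 11} \<inter> D = {8, 9, 10, 11} \<inter> (D \<inter> pverts even_gadget)"
    by (auto simp: pverts_even_gadget)
  ultimately show ?case unfolding D(2) by simp
next
  case (Suc t)
  then have "odd_dominating (extremal_graph t) (D \<inter> {..<16 + 3 * t})"
    by (simp add: odd_dominating_union_iff pair_graph_extremal pair_graph_triangle
        disjoint_extremal_triangle pverts_extremal[symmetric])
  from Suc.IH[OF this] show ?case by auto
qed

text \<open>
  Odd colours go exactly to the vertices of one odd-dominating set. In the gadgets there is no choice
  for this set; each triangle is coloured with the odd colours \<open>1, 3, 5\<close>.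
\<close>

lemma extremal_coloring:
  "\<exists>f. odd_sum_coloring (extremal_graph t) f \<and> f ` pverts (extremal_graph t) = {1..8}"
proof (induction t)
  case 0
  let ?f = "\<lambda>v. [1, 3, 5, 7, 5, 1, 2, 2] ! v :: nat" and ?g = "\<lambda>v. [2, 4, 6, 8, 1, 1, 1, 1] ! (v - 8) :: nat"
  have f: "odd_sum_coloring odd_gadget ?f"
    unfolding odd_sum_coloring_def
  proof
    show "coloring odd_gadget ?f"
      by (simp add: odd_gadget_def odd_gadget_edges_def coloring_graph_of)
    show "\<forall>v\<in>pverts odd_gadget. odd (\<Sum>w\<in>closed_nbhd odd_gadget v. ?f w)"
      unfolding pverts_odd_gadget by (simp add: closed_nbhd_odd_gadget[simplified])
  qed
  have g: "odd_sum_coloring even_gadget ?g"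
    unfolding odd_sum_coloring_def
  proof
    show "coloring even_gadget ?g"
      by (simp add: even_gadget_def even_gadget_edges_def coloring_graph_of)
    show "\<forall>v\<in>pverts even_gadget. odd (\<Sum>w\<in>closed_nbhd even_gadget v. ?g w)"
      unfolding pverts_even_gadget by (simp add: closed_nbhd_even_gadget)
  qed
  show ?case
  proof (intro exI conjI)
    show "odd_sum_coloring (extremal_graph 0) (\<lambda>v. if v \<in> pverts odd_gadget then ?f v else ?g v)"
      using odd_sum_coloring_union[OF pair_graph_odd_gadget pair_graph_even_gadget disjoint_gadgets f g] by simp
    show "(\<lambda>v. if v \<in> pverts odd_gadget then ?f v else ?g v) ` pverts (extremal_graph 0) = {1..8}"
      by (auto simp: pverts_odd_gadget pverts_even_gadget)
  qed
next
  case (Suc t)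
  then obtain f where f: "odd_sum_coloring (extremal_graph t) f"
    and im: "f ` pverts (extremal_graph t) = {1..8}" by blast
  let ?n = "16 + 3 * t"
  let ?g = "\<lambda>v. if v = ?n then 1 else if v = ?n + 1 then 3 else 5"
  let ?h = "\<lambda>v. if v \<in> pverts (extremal_graph t) then f v else ?g v"
  have g: "odd_sum_coloring (triangle_on ?n) ?g"
    unfolding odd_sum_coloring_def
  proof
    show "coloring (triangle_on ?n) ?g" by (simp add: triangle_on_def coloring_graph_of)
    show "\<forall>v\<in>pverts (triangle_on ?n). odd (\<Sum>w\<in>closed_nbhd (triangle_on ?n) v. ?g w)"
      unfolding pverts_triangle by (simp add: closed_nbhd_triangle[simplified])
  qed
  show ?case
  proof (intro exI conjI)
    show "odd_sum_coloring (extremal_graph (Suc t)) ?h"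
      using odd_sum_coloring_union[OF pair_graph_extremal pair_graph_triangle
          disjoint_extremal_triangle f g] by simp
    have "?h ` pverts (extremal_graph t) = {1..8}" unfolding im[symmetric] by (intro image_cong) auto
    moreover have "?h ` pverts (triangle_on ?n) \<subseteq> {1..8}"
      by (simp add: pverts_triangle pverts_extremal)
    ultimately show "?h ` pverts (extremal_graph (Suc t)) = {1..8}"
      unfolding extremal_graph.simps pverts_graph_union image_Un by blast
  qed
qed

lemma odd_sum_chromatic_number_extremal: "odd_sum_chromatic_number (extremal_graph t) = 8"
  unfolding odd_sum_chromatic_number_def
proof (rule Least_equality)
  show "\<exists>f. odd_sum_coloring (extremal_graph t) f \<and> card (f ` pverts (extremal_graph t)) = 8"
    using extremal_coloring[of t] by force
next
  fix k
  assume "\<exists>f. odd_sum_coloring (extremal_graph t) f \<and> card (f ` pverts (extremal_graph t)) = k"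
  then obtain f where f: "odd_sum_coloring (extremal_graph t) f"
    and k: "card (f ` pverts (extremal_graph t)) = k" by blast
  have "card {0::nat, 1, 2, 3} + card {8::nat, 9, 10, 11} \<le> card (f ` pverts (extremal_graph t))"
    using odd_dominating_extremalD by (intro card_colors_ge pair_graph_extremal f extremal_cliques)
  then show "8 \<le> k" unfolding k by simp
qed

theorem theorem5:
  "\<forall>t :: nat. \<exists>G :: nat pair_pre_digraph.
     pair_graph G \<and> planar G \<and> odd_sum_chromatic_number G = 8 \<and> ods G = 4 ^ t"
  by (intro allI exI conjI)
    (rule pair_graph_extremal planar_extremal odd_sum_chromatic_number_extremal ods_extremal)+

end
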